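(* Let $G$ be a graph. \begin{enumerate} \item $\lambda_{chr}(G)$ is non-zero, of sign $(-1)^{\deg(G)}$, where $\deg(G)=|G|-cc(G)$. \item Put $P_{chr}(G)=a_0+\cdots+a_nX^n$. \begin{itemize} \item For any $i$, $a_i\neq0$ if, and only if, $cc(G)\leq i\leq|G|$. \item If $cc(G)\leq i\leq|G|$, the sign of $a_i$ is $(-1)^{|G|-i}$. \end{itemize} \item $-a_{|G|-1}$ is the number of edges of $G$. \end{enumerate}
   Context: A graph is a pair $G=(V(G),E(G))$ with $V(G)$ a finite set and $E(G)$ a set of $2$-element subsets of $V(G)$; $|G|=\sharp V(G)$ and $cc(G)$ is the number of connected components of $G$ (so $cc(G)=0$ for the empty graph). $P_{chr}(G)\in\mathbb{Q}[X]$ is the chromatic polynomial: for $k\geq1$, $P_{chr}(G)(k)$ is the number of maps $f:V(G)\to\{1,\ldots,k\}$ with $f(x)\neq f(y)$ for every edge $\{x,y\}$. For $G$ connected, $\lambda_{chr}(G)=\frac{dP_{chr}(G)}{dX}(0)$; for an arbitrary graph, $\lambda_{chr}(G)$ is the product of the values of $\lambda_{chr}$ on the connected components of $G$ (equal to $1$ for the empty graph). Here $a_i$ is the coefficient of $X^i$ in $P_{chr}(G)$, understood as $0$ if there is no such term (in particular $a_{-1}=0$). *)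

theory Defs
  imports "HOL-Computational_Algebra.Polynomial" "HOL-Library.FuncSet"
begin

type_synonym 'a graph = "'a set \<times> 'a set set"

abbreviation verts :: "'a graph \<Rightarrow> 'a set" where "verts \<equiv> fst"
abbreviation edges :: "'a graph \<Rightarrow> 'a set set" where "edges \<equiv> snd"

definition is_graph :: "'a graph \<Rightarrow> bool" where
  "is_graph G \<longleftrightarrow> finite (verts G) \<and> (\<forall>e\<in>edges G. e \<subseteq> verts G \<and> card e = 2)"

definition induced_subgraph :: "'a graph \<Rightarrow> 'a set \<Rightarrow> 'a graph" where
  "induced_subgraph G C = (C, {e \<in> edges G. e \<subseteq> C})"

definition reachable :: "'a graph \<Rightarrow> ('a \<times> 'a) set" where
  "reachable G = {(x, y). {x, y} \<in> edges G}\<^sup>* \<inter> verts G \<times> verts G"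

definition components :: "'a graph \<Rightarrow> 'a set set" where
  "components G = verts G // reachable G"

definition cc :: "'a graph \<Rightarrow> nat" where
  "cc G = card (components G)"

text \<open>The empty graph is not connected: it has no connected component.\<close>

definition connected_graph :: "'a graph \<Rightarrow> bool" where
  "connected_graph G \<longleftrightarrow> cc G = 1"

definition graph_deg :: "'a graph \<Rightarrow> int" where
  "graph_deg G = int (card (verts G)) - int (cc G)"

definition colourings :: "'a graph \<Rightarrow> nat \<Rightarrow> ('a \<Rightarrow> nat) set" where
  "colourings G k = {f \<in> verts G \<rightarrow>\<^sub>E {1..k}. \<forall>x y. {x, y} \<in> edges G \<longrightarrow> f x \<noteq> f y}"

text \<open>Existence and uniqueness are proved in \<open>P_chr_ex1\<close> below.\<close>

definition P_chr :: "'a graph \<Rightarrow> rat poly" where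
  "P_chr G = (THE p. \<forall>k\<ge>1. poly p (of_nat k) = of_nat (card (colourings G k)))"

text \<open>
  The product definition agrees with the derivative at 0 on connected graphs, see
  \<open>lambda_chr_connected\<close> below.
\<close>

definition lambda_chr :: "'a graph \<Rightarrow> rat" where
  "lambda_chr G = (\<Prod>C\<in>components G. poly (pderiv (P_chr (induced_subgraph G C))) 0)"

text \<open>Coefficients with integer index, so that the coefficient of index -1 makes sense.\<close>

definition icoeff :: "'b::zero poly \<Rightarrow> int \<Rightarrow> 'b" where
  "icoeff p i = (if i < 0 then 0 else coeff p (nat i))"

lemma card_colourings_image:
  assumes "is_graph G" "finite S"
  shows "card {f \<in> verts G \<rightarrow>\<^sub>E S. f ` verts G = S \<and> (\<forall>x y. {x, y} \<in> edges G \<longrightarrow> f x \<noteq> f y)}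
       = card {f \<in> colourings G (card S). f ` verts G = {1..card S}}"
proof -
  obtain h where h: "bij_betw h S {1..card S}"
    using assms(2)
    by (metis bij_betw_iff_card card_atLeastAtMost diff_Suc_1 finite_atLeastAtMost)
  define g where "g = inv_into S h"
  have g: "bij_betw g {1..card S} S" unfolding g_def using h by (rule bij_betw_inv_into)
  have hg: "h (g y) = y" if "y \<in> {1..card S}" for y
    using h that unfolding g_def by (simp add: bij_betw_inv_into_right)
  have gh: "g (h y) = y" if "y \<in> S" for y
    using h that unfolding g_def by (simp add: bij_betw_inv_into_left)
  have ed: "x \<in> verts G \<and> y \<in> verts G" if "{x, y} \<in> edges G" for x y
    using \<open>is_graph G\<close> that unfolding is_graph_def by blast
  have hS: "h ` S = {1..card S}" and gS: "g ` {1..card S} = S"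
    using h g by (auto simp: bij_betw_def)
  have ih: "inj_on h S" and ig: "inj_on g {1..card S}" using h g by (auto simp: bij_betw_def)
  let ?A = "{f \<in> verts G \<rightarrow>\<^sub>E S. f ` verts G = S \<and> (\<forall>x y. {x, y} \<in> edges G \<longrightarrow> f x \<noteq> f y)}"
  let ?B = "{f \<in> colourings G (card S). f ` verts G = {1..card S}}"
  have "bij_betw (\<lambda>f. restrict (h \<circ> f) (verts G)) ?A ?B"
  proof (rule bij_betw_byWitness[where f' = "\<lambda>f. restrict (g \<circ> f) (verts G)"])
    show "\<forall>f\<in>?A. restrict (g \<circ> restrict (h \<circ> f) (verts G)) (verts G) = f"
      by (auto simp: fun_eq_iff restrict_def PiE_iff extensional_def gh)
    show "\<forall>f\<in>?B. restrict (h \<circ> restrict (g \<circ> f) (verts G)) (verts G) = f"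
      unfolding colourings_def
      by (auto simp: fun_eq_iff restrict_def PiE_iff extensional_def intro!: hg)
    show "(\<lambda>f. restrict (h \<circ> f) (verts G)) ` ?A \<subseteq> ?B"
    proof (rule image_subsetI)
      fix f assume f: "f \<in> ?A"
      have "h (f x) \<noteq> h (f y)" if "{x, y} \<in> edges G" for x y
        using f ed[OF that] that ih unfolding inj_on_def PiE_iff by blast
      moreover have "(h \<circ> f) ` verts G = {1..card S}"
        using f hS by (simp only: image_comp[symmetric] mem_Collect_eq)
      ultimately show "restrict (h \<circ> f) (verts G) \<in> ?B"
        unfolding colourings_def using ed by (auto simp: PiE_iff)
    qed
    show "(\<lambda>f. restrict (g \<circ> f) (verts G)) ` ?B \<subseteq> ?A"
    proof (rule image_subsetI)
      fix f assume f: "f \<in> ?B"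
      have "g (f x) \<noteq> g (f y)" if "{x, y} \<in> edges G" for x y
        using f ed[OF that] that ig unfolding colourings_def inj_on_def PiE_iff by blast
      moreover have "(g \<circ> f) ` verts G = S"
        using f gS by (simp only: image_comp[symmetric] mem_Collect_eq)
      ultimately show "restrict (g \<circ> f) (verts G) \<in> ?A"
        using ed by (auto simp: PiE_iff)
    qed
  qed
  then show ?thesis by (rule bij_betw_same_card)
qed

lemma choose_poly: "\<exists>p :: rat poly. \<forall>k. poly p (of_nat k) = of_nat (k choose j)"
proof -
  let ?p = "smult (1 / fact j) (\<Prod>i<j. [:- of_nat i, 1:]) :: rat poly"
  have "poly ?p (of_nat k) = of_nat (k choose j)" for k
    by (simp add: poly_prod binomial_gbinomial gbinomial_prod_rev atLeast0LessThan)
  then show ?thesis by blast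
qed

lemma P_chr_ex1:
  assumes "is_graph G"
  shows "\<exists>!p :: rat poly. \<forall>k\<ge>1. poly p (of_nat k) = of_nat (card (colourings G k))"
proof -
  define c where "c j = card {f \<in> colourings G j. f ` verts G = {1..j}}" for j
  obtain b :: "nat \<Rightarrow> rat poly" where b: "poly (b j) (of_nat k) = of_nat (k choose j)" for j k
    using choose_poly by metis
  have fin: "finite (verts G)" using assms by (simp add: is_graph_def)
  have finc: "finite (colourings G k)" for k
    unfolding colourings_def by (rule finite_subset[of _ "verts G \<rightarrow>\<^sub>E {1..k}"]) (auto intro: finite_PiE fin)
  have c0: "c j = 0" if "card (verts G) < j" for j
  proof -
    have "f ` verts G \<noteq> {1..j}" for f
      using card_image_le[OF fin, of f] that by auto
    then show ?thesis by (simp add: c_def)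
  qed
  have count: "card (colourings G k) = (\<Sum>j\<le>card (verts G). c j * (k choose j))" for k
  proof -
    have "card (colourings G k) = (\<Sum>S\<in>Pow {1..k}. card {f \<in> colourings G k. f ` verts G = S})"
    proof -
      have "colourings G k = (\<Union>S\<in>Pow {1..k}. {f \<in> colourings G k. f ` verts G = S})"
        unfolding colourings_def by (auto simp: PiE_iff)
      also have "card \<dots> = (\<Sum>S\<in>Pow {1..k}. card {f \<in> colourings G k. f ` verts G = S})"
        by (rule card_UN_disjoint) (auto simp: finc)
      finally show ?thesis .
    qed
    also have "\<dots> = (\<Sum>S\<in>Pow {1..k}. c (card S))"
    proof (rule sum.cong[OF refl])
      fix S assume S: "S \<in> Pow {1..k}"
      have "{f \<in> colourings G k. f ` verts G = S} = {f \<in> verts G \<rightarrow>\<^sub>E S. f ` verts G = S \<and>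
              (\<forall>x y. {x, y} \<in> edges G \<longrightarrow> f x \<noteq> f y)}"
        using S unfolding colourings_def by (auto simp: PiE_iff)
      then show "card {f \<in> colourings G k. f ` verts G = S} = c (card S)"
        unfolding c_def using card_colourings_image[OF assms, of S] S finite_subset by fastforce
    qed
    also have "\<dots> = (\<Sum>j\<le>k. \<Sum>S | S \<in> Pow {1..k} \<and> card S = j. c (card S))"
      by (rule sum.group[symmetric]) (auto dest: card_mono[rotated])
    also have "\<dots> = (\<Sum>j\<le>k. c j * (k choose j))"
    proof (rule sum.cong[OF refl])
      fix j
      have "(\<Sum>S | S \<in> Pow {1..k} \<and> card S = j. c (card S)) = (\<Sum>S | S \<subseteq> {1..k} \<and> card S = j. c j)"
        by (rule sum.cong) auto
      then show "(\<Sum>S | S \<in> Pow {1..k} \<and> card S = j. c (card S)) = c j * (k choose j)"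
        using n_subsets[of "{1..k}" j] by simp
    qed
    also have "\<dots> = (\<Sum>j\<le>max k (card (verts G)). c j * (k choose j))"
      by (rule sum.mono_neutral_left) auto
    also have "\<dots> = (\<Sum>j\<le>card (verts G). c j * (k choose j))"
      by (rule sum.mono_neutral_right) (auto simp: c0)
    finally show ?thesis .
  qed
  show ?thesis
  proof (rule ex1I)
    show "\<forall>k\<ge>1. poly (\<Sum>j\<le>card (verts G). smult (of_nat (c j)) (b j)) (of_nat k)
            = of_nat (card (colourings G k))"
      by (simp add: poly_sum b count)
  next
    fix p :: "rat poly"
    assume p: "\<forall>k\<ge>1. poly p (of_nat k) = of_nat (card (colourings G k))"
    let ?q = "\<Sum>j\<le>card (verts G). smult (of_nat (c j)) (b j)"
    have "poly (p - ?q) (of_nat k) = 0" if "k \<ge> 1" for k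
      using p that by (simp add: poly_sum b count)
    then have "of_nat ` {1..} \<subseteq> {x. poly (p - ?q) x = 0}" by auto
    moreover have "infinite (of_nat ` {1::nat..} :: rat set)"
      by (subst finite_image_iff) (auto simp: inj_on_def infinite_Ici)
    ultimately have "p - ?q = 0" using poly_roots_finite finite_subset by blast
    then show "p = ?q" by simp
  qed
qed

lemma lambda_chr_connected:
  assumes "is_graph G" "connected_graph G"
  shows "lambda_chr G = poly (pderiv (P_chr G)) 0"
proof -
  obtain C where C: "components G = {C}"
    using assms(2) unfolding connected_graph_def cc_def by (rule card_1_singletonE)
  have "\<Union>(components G) = verts G"
    unfolding components_def quotient_def reachable_def by auto
  with C have "C = verts G" by simp
  moreover have "induced_subgraph G (verts G) = G"
    using assms(1) unfolding induced_subgraph_def is_graph_def by (cases G) auto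
  ultimately show ?thesis by (simp add: lambda_chr_def C)
qed

lemma equiv_reachable: "equiv (verts G) (reachable G)"
proof (rule equivI)
  have "sym ({(x, y). {x, y} \<in> edges G}\<^sup>*)"
    by (rule sym_rtrancl) (auto simp: sym_def insert_commute)
  then show "sym (reachable G)" by (auto simp: reachable_def sym_def)
  show "trans (reachable G)" unfolding reachable_def by (rule transI) auto
qed (auto simp: reachable_def refl_on_def)

end

theory Submission
  imports Defs
begin

text \<open>
  Everything comes from deletion-contraction. For an edge \<open>{x, y}\<close> of \<open>G\<close>, a proper colouring of
  \<open>G\<close> minus this edge either separates \<open>x\<close> and \<open>y\<close>, and is then a proper colouring of \<open>G\<close>, or
  identifies them, and is then a proper colouring of \<open>G\<close> with \<open>x\<close> and \<open>y\<close> merged; hence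
  \<open>P(G) = P(G - e) - P(G / e)\<close> (\<open>P_chr_delete_contract\<close>).

  Because \<open>G / e\<close> has one vertex less, the normalised coefficients \<open>(-1) ^ (|G| - i) * a\<^sub>i\<close> simply
  add up: those of \<open>G\<close> are the sums of those of \<open>G - e\<close> and \<open>G / e\<close>. By induction on the number of
  edges they are nonnegative, so no cancellation can happen and the support of \<open>P(G)\<close> is the union
  of the two supports. Contracting an edge keeps the number of components and deleting one does not
  decrease it, so that union is \<open>[cc G, |G| - 1] \<union> [cc (G - e), |G|] = [cc G, |G|]\<close>.
  The same recursion makes \<open>P(G)\<close> monic and adds one to \<open>- a\<^bsub>|G| - 1\<^esub>\<close> for every
  edge (\<open>P_chr_coeff\<close>).

  The claim on \<open>\<lambda>\<close> is the case \<open>i = 1 = cc\<close> of the claim on coefficients for each component,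
  multiplied over all components.
\<close>

section \<open>Characterisation of the chromatic polynomial\<close>

lemma poly_P_chr:
  assumes "is_graph G" "k \<ge> 1"
  shows "poly (P_chr G) (of_nat k) = of_nat (card (colourings G k))"
  using theI'[OF P_chr_ex1[OF assms(1)]] assms(2) unfolding P_chr_def by blast

lemma P_chr_eqI:
  assumes "is_graph G"
    and "\<And>k. k \<ge> 1 \<Longrightarrow> poly p (of_nat k) = of_nat (card (colourings G k))"
  shows "P_chr G = p"
  using P_chr_ex1[OF assms(1)] poly_P_chr[OF assms(1)] assms(2) by blast

lemma finite_edges:
  assumes "is_graph G"
  shows "finite (edges G)"
proof (rule finite_subset)
  show "edges G \<subseteq> Pow (verts G)" using assms by (auto simp: is_graph_def)
  show "finite (Pow (verts G))" using assms by (simp add: is_graph_def)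
qed

lemma edgeE:
  assumes "is_graph G" "e \<in> edges G"
  obtains x y where "e = {x, y}" "x \<noteq> y" "x \<in> verts G" "y \<in> verts G"
proof -
  have "card e = 2" "e \<subseteq> verts G" using assms by (auto simp: is_graph_def)
  then show thesis using that by (auto simp: card_2_iff)
qed

lemma finite_colourings:
  assumes "is_graph G"
  shows "finite (colourings G k)"
proof (rule finite_subset)
  show "colourings G k \<subseteq> verts G \<rightarrow>\<^sub>E {1..k}" by (auto simp: colourings_def)
  show "finite (verts G \<rightarrow>\<^sub>E {1..k})" using assms by (intro finite_PiE) (auto simp: is_graph_def)
qed

lemma P_chr_edgeless:
  assumes "is_graph G" "edges G = {}"
  shows "P_chr G = monom 1 (card (verts G))"
proof (rule P_chr_eqI[OF assms(1)])
  fix k :: nat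
  have "colourings G k = verts G \<rightarrow>\<^sub>E {1..k}" by (simp add: colourings_def assms(2))
  then show "poly (monom 1 (card (verts G))) (of_nat k) = (of_nat (card (colourings G k)) :: rat)"
    using assms(1) by (simp add: card_PiE poly_monom is_graph_def)
qed

section \<open>Reachability and the number of components\<close>

lemma reachable_trans:
  "(a, b) \<in> reachable G \<Longrightarrow> (b, c) \<in> reachable G \<Longrightarrow> (a, c) \<in> reachable G"
  using equiv_reachable[of G] by (meson equivE transD)

lemma reachable_sym: "(a, b) \<in> reachable G \<Longrightarrow> (b, a) \<in> reachable G"
  using equiv_reachable[of G] by (meson equivE symD)

lemma reachable_refl: "a \<in> verts G \<Longrightarrow> (a, a) \<in> reachable G"
  by (simp add: reachable_def)

lemma reachable_edge:
  "{a, b} \<in> edges G \<Longrightarrow> a \<in> verts G \<Longrightarrow> b \<in> verts G \<Longrightarrow> (a, b) \<in> reachable G"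
  by (auto simp: reachable_def)

lemma components_image: "components G = (\<lambda>v. reachable G `` {v}) ` verts G"
  by (auto simp: components_def quotient_def)

lemma cc_le_card_verts:
  assumes "is_graph G"
  shows "cc G \<le> card (verts G)"
  unfolding cc_def components_image using assms by (intro card_image_le) (simp add: is_graph_def)

lemma reachable_map:
  assumes "is_graph G"
    and f: "\<And>v. v \<in> verts G \<Longrightarrow> f v \<in> verts H"
    and edge: "\<And>a b. {a, b} \<in> edges G \<Longrightarrow> (f a, f b) \<in> reachable H"
    and ab: "(a, b) \<in> reachable G"
  shows "(f a, f b) \<in> reachable H"
proof -
  have "(a, b) \<in> {(x, y). {x, y} \<in> edges G}\<^sup>*" "a \<in> verts G"
    using ab by (auto simp: reachable_def)
  then show ?thesis
  proof (induction rule: rtrancl_induct)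
    case base
    then show ?case using f reachable_refl by fast
  next
    case (step b c)
    then show ?case using edge reachable_trans by fast
  qed
qed

text \<open>
  A map of vertices that sends edges to paths induces a map between the sets of components;
  if it meets every component of the target, this induced map is onto.
\<close>

lemma cc_le_of_map:
  assumes "is_graph G"
    and f: "\<And>v. v \<in> verts G \<Longrightarrow> f v \<in> verts H"
    and edge: "\<And>a b. {a, b} \<in> edges G \<Longrightarrow> (f a, f b) \<in> reachable H"
    and cover: "\<And>v. v \<in> verts H \<Longrightarrow> \<exists>u\<in>verts G. (f u, v) \<in> reachable H"
  shows "cc H \<le> cc G"
proof -
  have "components H \<subseteq> (\<lambda>C. reachable H `` (f ` C)) ` components G"
  proof
    fix D assume "D \<in> components H"
    then obtain v where v: "v \<in> verts H" "D = reachable H `` {v}" by (auto simp: components_image)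
    from cover[OF v(1)] obtain u where u: "u \<in> verts G" "(f u, v) \<in> reachable H" by blast
    have D: "D = reachable H `` {f u}"
      using v(2) u(2) reachable_sym reachable_trans by fast
    have "reachable H `` (f ` (reachable G `` {u})) = reachable H `` {f u}"
    proof
      show "reachable H `` (f ` (reachable G `` {u})) \<subseteq> reachable H `` {f u}"
        using reachable_map[OF assms(1) f edge] reachable_trans by fast
      show "reachable H `` {f u} \<subseteq> reachable H `` (f ` (reachable G `` {u}))"
        using reachable_refl[OF u(1)] by blast
    qed
    then show "D \<in> (\<lambda>C. reachable H `` (f ` C)) ` components G"
      using u(1) D by (auto simp: components_image)
  qed
  moreover have "finite (components G)"
    using assms(1) by (simp add: components_image is_graph_def)
  ultimately show ?thesis unfolding cc_def by (metis surj_card_le)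
qed

lemma cc_edgeless:
  assumes "edges G = {}"
  shows "cc G = card (verts G)"
proof -
  have "components G = (\<lambda>v. {v}) ` verts G"
    using assms by (auto simp: components_image reachable_def)
  then show ?thesis by (simp add: cc_def card_image)
qed

section \<open>Deletion and contraction\<close>

definition delete_edge :: "'a graph \<Rightarrow> 'a set \<Rightarrow> 'a graph" where
  "delete_edge G e = (verts G, edges G - {e})"

text \<open>
  The vertex \<open>x\<close> of the contracted graph stands for the merged pair \<open>x\<close>, \<open>y\<close>. Since edges form a
  set, parallel edges created by the contraction are merged as well.
\<close>

definition contract_edge :: "'a graph \<Rightarrow> 'a \<Rightarrow> 'a \<Rightarrow> 'a graph" where
  "contract_edge G x y = (verts G - {y}, image (id(y := x)) ` (edges G - {{x, y}}))"

lemma is_graph_delete_edge: "is_graph G \<Longrightarrow> is_graph (delete_edge G e)"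
  by (simp add: is_graph_def delete_edge_def)

lemma is_graph_contract_edge:
  assumes "is_graph G" "x \<in> verts G" "x \<noteq> y"
  shows "is_graph (contract_edge G x y)"
proof -
  let ?\<phi> = "id(y := x)"
  have "?\<phi> ` d \<subseteq> verts G - {y} \<and> card (?\<phi> ` d) = 2" if d: "d \<in> edges G" "d \<noteq> {x, y}" for d
  proof -
    obtain a b where ab: "d = {a, b}" "a \<noteq> b" "a \<in> verts G" "b \<in> verts G"
      using edgeE[OF assms(1) d(1)] by blast
    then have "?\<phi> a \<noteq> ?\<phi> b" using d(2) by auto
    then have "card (?\<phi> ` d) = 2"
      by (simp only: ab(1) image_insert image_empty card_2_iff) blast
    then show ?thesis using ab assms(2,3) by auto
  qed
  moreover have "finite (verts G)" using assms(1) by (simp add: is_graph_def)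
  ultimately show ?thesis by (auto simp: is_graph_def contract_edge_def)
qed

lemma contract_edgeE:
  assumes "is_graph G" "{a, b} \<in> edges (contract_edge G x y)"
  obtains c d where "{c, d} \<in> edges G - {{x, y}}" "c \<in> verts G" "d \<in> verts G"
    "a = (id(y := x)) c" "b = (id(y := x)) d"
proof -
  let ?\<phi> = "id(y := x)"
  obtain e where e: "e \<in> edges G - {{x, y}}" "{a, b} = ?\<phi> ` e"
    using assms(2) by (auto simp: contract_edge_def)
  obtain c d where cd: "e = {c, d}" "c \<in> verts G" "d \<in> verts G"
    using edgeE[OF assms(1), of e] e(1) by blast
  have "{a, b} = {?\<phi> c, ?\<phi> d}" using e(2) cd(1) by simp
  then consider "a = ?\<phi> c" "b = ?\<phi> d" | "a = ?\<phi> d" "b = ?\<phi> c"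
    unfolding doubleton_eq_iff by blast
  then show thesis
    using that[of c d] that[of d c] cd e(1) by cases (simp_all add: insert_commute)
qed

lemma contract_edgeI:
  assumes "{a, b} \<in> edges G" "{a, b} \<noteq> {x, y}"
  shows "{(id(y := x)) a, (id(y := x)) b} \<in> edges (contract_edge G x y)"
proof -
  have "(id(y := x)) ` {a, b} \<in> edges (contract_edge G x y)"
    unfolding contract_edge_def snd_conv using assms by blast
  then show ?thesis by (simp only: image_insert image_empty)
qed

lemma cc_delete_edge:
  assumes "is_graph G"
  shows "cc G \<le> cc (delete_edge G e)"
proof (rule cc_le_of_map[where f = id, OF is_graph_delete_edge[OF assms]])
  fix a b assume ab: "{a, b} \<in> edges (delete_edge G e)"
  then have "{a, b} \<in> edges G" by (simp add: delete_edge_def)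
  moreover from this have "{a, b} \<subseteq> verts G" using assms unfolding is_graph_def by blast
  ultimately show "(id a, id b) \<in> reachable G" by (simp add: reachable_edge)
qed (auto simp: delete_edge_def intro: reachable_refl)

text \<open>
  The quotient map from \<open>G\<close> to its contraction and the inclusion of the vertices back into \<open>G\<close>
  both send edges to paths, the latter because \<open>x\<close> and \<open>y\<close> are adjacent in \<open>G\<close>.
\<close>

lemma cc_contract_edge:
  assumes G: "is_graph G" and e: "{x, y} \<in> edges G" and xy: "x \<noteq> y"
  shows "cc (contract_edge G x y) = cc G"
proof (rule antisym)
  let ?\<phi> = "id(y := x)" and ?H = "contract_edge G x y"
  have x: "x \<in> verts G" and y: "y \<in> verts G" using G e by (auto simp: is_graph_def)
  have H: "is_graph ?H" by (rule is_graph_contract_edge[OF G x xy])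
  have vH: "verts ?H = verts G - {y}" by (simp add: contract_edge_def)
  have \<phi>: "?\<phi> v \<in> verts ?H" if "v \<in> verts G" for v using that x xy by (simp add: vH)
  show "cc ?H \<le> cc G"
  proof (rule cc_le_of_map[where f = ?\<phi>, OF G \<phi>])
    fix a b assume ab: "{a, b} \<in> edges G"
    then have v: "a \<in> verts G" "b \<in> verts G" using G by (auto simp: is_graph_def)
    show "(?\<phi> a, ?\<phi> b) \<in> reachable ?H"
    proof (cases "{a, b} = {x, y}")
      case True
      then have "?\<phi> a = x" "?\<phi> b = x" by (auto simp: doubleton_eq_iff)
      then show ?thesis using x xy by (simp add: reachable_refl vH)
    next
      case False
      show ?thesis by (rule reachable_edge[OF contract_edgeI[OF ab False] \<phi>[OF v(1)] \<phi>[OF v(2)]])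
    qed
  next
    fix v assume v: "v \<in> verts ?H"
    then show "\<exists>u\<in>verts G. (?\<phi> u, v) \<in> reachable ?H"
      by (intro bexI[of _ v]) (auto simp: reachable_refl vH)
  qed
  have c\<phi>: "(c, ?\<phi> c) \<in> reachable G" if "c \<in> verts G" for c
    using that x y reachable_sym[OF reachable_edge[OF e x y]] by (simp add: reachable_refl)
  show "cc G \<le> cc ?H"
  proof (rule cc_le_of_map[where f = id, OF H])
    fix a b assume "{a, b} \<in> edges ?H"
    then obtain c d where cd: "{c, d} \<in> edges G - {{x, y}}" "c \<in> verts G" "d \<in> verts G"
      "a = ?\<phi> c" "b = ?\<phi> d" using contract_edgeE[OF G] by metis
    have "(c, d) \<in> reachable G" using cd by (intro reachable_edge) auto
    then have "(?\<phi> c, ?\<phi> d) \<in> reachable G"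
      by (rule reachable_trans[OF reachable_trans[OF reachable_sym[OF c\<phi>[OF cd(2)]]] c\<phi>[OF cd(3)]])
    then show "(id a, id b) \<in> reachable G" using cd by simp
  next
    fix v assume v: "v \<in> verts G"
    show "\<exists>u\<in>verts ?H. (id u, v) \<in> reachable G"
      using \<phi>[OF v] reachable_sym[OF c\<phi>[OF v]] by auto
  qed (auto simp: vH)
qed

text \<open>
  The colourings of the contracted graph are those colourings of the graph without the edge in which
  the end vertices agree: \<open>y\<close> is forgotten, and recovered by giving it the colour of \<open>x\<close>.
\<close>

lemma card_colourings_contract_edge:
  assumes G: "is_graph G" and e: "{x, y} \<in> edges G" and xy: "x \<noteq> y"
  shows "card (colourings (contract_edge G x y) k) =
    card {f \<in> colourings (delete_edge G {x, y}) k. f x = f y}"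
proof -
  let ?\<phi> = "id(y := x)" and ?H = "contract_edge G x y"
  let ?B = "{f \<in> colourings (delete_edge G {x, y}) k. f x = f y}"
  have x: "x \<in> verts G" and y: "y \<in> verts G" using G e by (auto simp: is_graph_def)
  have vH: "verts ?H = verts G - {y}" by (simp add: contract_edge_def)
  have "bij_betw (\<lambda>f. f(y := f x)) (colourings ?H k) ?B"
  proof (rule bij_betw_byWitness[where f' = "\<lambda>f. restrict f (verts G - {y})"])
    show "\<forall>f\<in>colourings ?H k. restrict (f(y := f x)) (verts G - {y}) = f"
      by (auto simp: colourings_def vH PiE_iff extensional_def fun_eq_iff)
    show "\<forall>f\<in>?B. (restrict f (verts G - {y}))(y := restrict f (verts G - {y}) x) = f"
      using x y xy
      by (auto simp: colourings_def delete_edge_def PiE_iff extensional_def fun_eq_iff)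
    show "(\<lambda>f. f(y := f x)) ` colourings ?H k \<subseteq> ?B"
    proof (rule image_subsetI)
      fix f assume f: "f \<in> colourings ?H k"
      have "(f(y := f x)) a \<noteq> (f(y := f x)) b"
        if ab: "{a, b} \<in> edges G" "{a, b} \<noteq> {x, y}" for a b
      proof -
        have "f (?\<phi> a) \<noteq> f (?\<phi> b)"
          using contract_edgeI[OF ab] f unfolding colourings_def by blast
        then show ?thesis by auto
      qed
      moreover have "f(y := f x) \<in> verts G \<rightarrow>\<^sub>E {1..k}"
        using f x y xy by (auto simp: colourings_def vH PiE_iff extensional_def)
      ultimately show "f(y := f x) \<in> ?B"
        using xy unfolding colourings_def delete_edge_def by simp
    qed
    show "(\<lambda>f. restrict f (verts G - {y})) ` ?B \<subseteq> colourings ?H k"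
    proof (rule image_subsetI)
      fix f assume f: "f \<in> ?B"
      have "restrict f (verts G - {y}) a \<noteq> restrict f (verts G - {y}) b"
        if ab: "{a, b} \<in> edges ?H" for a b
      proof -
        obtain c d where cd: "{c, d} \<in> edges G - {{x, y}}" "c \<in> verts G" "d \<in> verts G"
          "a = ?\<phi> c" "b = ?\<phi> d" using contract_edgeE[OF G ab] .
        have "f c \<noteq> f d" using f cd(1) by (auto simp: colourings_def delete_edge_def)
        moreover have "restrict f (verts G - {y}) (?\<phi> v) = f v" if "v \<in> verts G" for v
          using that f x xy by auto
        ultimately show ?thesis using cd by presburger
      qed
      moreover have "restrict f (verts G - {y}) \<in> verts ?H \<rightarrow>\<^sub>E {1..k}"
        using f by (auto simp: colourings_def delete_edge_def vH PiE_iff)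
      ultimately show "restrict f (verts G - {y}) \<in> colourings ?H k"
        unfolding colourings_def by simp
    qed
  qed
  then show ?thesis by (rule bij_betw_same_card)
qed

lemma P_chr_delete_contract:
  assumes G: "is_graph G" and e: "{x, y} \<in> edges G" and xy: "x \<noteq> y"
  shows "P_chr G = P_chr (delete_edge G {x, y}) - P_chr (contract_edge G x y)"
proof (rule P_chr_eqI[OF G])
  fix k :: nat assume k: "k \<ge> 1"
  let ?D = "delete_edge G {x, y}" and ?H = "contract_edge G x y"
  have x: "x \<in> verts G" using G e by (auto simp: is_graph_def)
  have D: "is_graph ?D" and H: "is_graph ?H"
    using is_graph_delete_edge[OF G] is_graph_contract_edge[OF G x xy] by auto
  have "colourings ?D k = colourings G k \<union> {f \<in> colourings ?D k. f x = f y}"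
  proof -
    have "f \<in> colourings G k" if f: "f \<in> colourings ?D k" "f x \<noteq> f y" for f
    proof -
      have "f a \<noteq> f b" if "{a, b} \<in> edges G" for a b
        using that f unfolding colourings_def delete_edge_def
        by (cases "{a, b} = {x, y}") (auto simp: doubleton_eq_iff)
      then show ?thesis using f(1) by (simp add: colourings_def delete_edge_def)
    qed
    moreover have "colourings G k \<subseteq> colourings ?D k"
      by (auto simp: colourings_def delete_edge_def)
    ultimately show ?thesis by blast
  qed
  moreover have "colourings G k \<inter> {f \<in> colourings ?D k. f x = f y} = {}"
    using e by (auto simp: colourings_def)
  ultimately have "card (colourings ?D k) =
      card (colourings G k) + card {f \<in> colourings ?D k. f x = f y}"
    using card_Un_disjoint finite_colourings[OF G] finite_colourings[OF D]
    by (metis (no_types, lifting) finite_Un)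
  then have "card (colourings ?D k) = card (colourings G k) + card (colourings ?H k)"
    by (simp add: card_colourings_contract_edge[OF G e xy])
  then show "poly (P_chr ?D - P_chr ?H) (of_nat k) = of_nat (card (colourings G k))"
    by (simp add: poly_P_chr[OF D k] poly_P_chr[OF H k])
qed

section \<open>Coefficients of the chromatic polynomial\<close>

text \<open>
  The exponent is \<open>|G| + i\<close> rather than \<open>|G| - i\<close>, which has the same parity and needs no bound
  on \<open>i\<close>. Splitting the sign statement into nonnegativity and support lets it pass through
  the recursion: a sum of two nonnegative numbers vanishes only if both do. Monicity has to
  be carried along, as it provides the summand that counts the deleted edge.
\<close>

lemma P_chr_coeff:
  fixes G :: "'a graph"
  assumes "is_graph G"
  shows "(\<forall>i. (- 1) ^ (card (verts G) + i) * coeff (P_chr G) i \<ge> 0)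
    \<and> (\<forall>i. coeff (P_chr G) i \<noteq> 0 \<longleftrightarrow> cc G \<le> i \<and> i \<le> card (verts G))
    \<and> coeff (P_chr G) (card (verts G)) = 1
    \<and> (\<forall>m. card (verts G) = Suc m \<longrightarrow> coeff (P_chr G) m = - of_nat (card (edges G)))"
  using assms
proof (induction "card (edges G)" arbitrary: G rule: less_induct)
  case less
  note G = less.prems
  show ?case
  proof (cases "edges G = {}")
    case True
    then show ?thesis by (auto simp: P_chr_edgeless[OF G] cc_edgeless coeff_monom)
  next
    case False
    then obtain x y where e: "{x, y} \<in> edges G" and xy: "x \<noteq> y" and x: "x \<in> verts G"
        and y: "y \<in> verts G"
      using edgeE[OF G] by blast
    define D where "D = delete_edge G {x, y}"
    define H where "H = contract_edge G x y"
    note finE = finite_edges[OF G]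
    have D: "is_graph D" unfolding D_def by (rule is_graph_delete_edge[OF G])
    have H: "is_graph H" unfolding H_def by (rule is_graph_contract_edge[OF G x xy])
    have eD: "card (edges G) = Suc (card (edges D))"
      using card_Suc_Diff1[OF finE e] by (simp add: D_def delete_edge_def)
    have "card (edges H) \<le> card (edges D)"
      unfolding H_def D_def contract_edge_def delete_edge_def snd_conv
      using finE by (intro card_image_le) simp
    then have eH: "card (edges H) < card (edges G)" using eD by simp
    have vD: "verts D = verts G" by (simp add: D_def delete_edge_def)
    have finV: "finite (verts G)" using G by (simp add: is_graph_def)
    define n where "n = card (verts H)"
    have vG: "card (verts G) = Suc n"
      using card_Suc_Diff1[OF finV y] by (simp add: H_def n_def contract_edge_def)
    have IHD: "\<And>i. (- 1) ^ (Suc n + i) * coeff (P_chr D) i \<ge> 0"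
      "\<And>i. coeff (P_chr D) i \<noteq> 0 \<longleftrightarrow> cc D \<le> i \<and> i \<le> Suc n"
      "coeff (P_chr D) (Suc n) = 1" "coeff (P_chr D) n = - of_nat (card (edges D))"
      using less.hyps[of D] eD D vD vG by auto
    have IHH: "\<And>i. (- 1) ^ (n + i) * coeff (P_chr H) i \<ge> 0"
      "\<And>i. coeff (P_chr H) i \<noteq> 0 \<longleftrightarrow> cc H \<le> i \<and> i \<le> n"
      "coeff (P_chr H) n = 1"
      using less.hyps[of H] eH H n_def by auto
    have ccH: "cc H = cc G" unfolding H_def by (rule cc_contract_edge[OF G e xy])
    have ccD: "cc G \<le> cc D" unfolding D_def by (rule cc_delete_edge[OF G])
    have ccn: "cc D \<le> Suc n" using cc_le_card_verts[OF D] vD vG by simp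
    have P: "coeff (P_chr G) i = coeff (P_chr D) i - coeff (P_chr H) i" for i
      using P_chr_delete_contract[OF G e xy] by (simp add: D_def H_def)
    have b: "(- 1) ^ (Suc n + i) * coeff (P_chr G) i =
        (- 1) ^ (Suc n + i) * coeff (P_chr D) i + (- 1) ^ (n + i) * coeff (P_chr H) i" for i
      by (simp add: P algebra_simps)
    have "(- 1) ^ (Suc n + i) * coeff (P_chr G) i \<ge> 0" for i
      unfolding b using IHD(1) IHH(1) by (rule add_nonneg_nonneg)
    moreover have "coeff (P_chr G) i \<noteq> 0 \<longleftrightarrow> cc G \<le> i \<and> i \<le> Suc n" for i
    proof -
      have "coeff (P_chr G) i = 0 \<longleftrightarrow> (- 1) ^ (Suc n + i) * coeff (P_chr G) i = 0" by simp
      also have "\<dots> \<longleftrightarrow> (- 1) ^ (Suc n + i) * coeff (P_chr D) i = 0 \<and>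
          (- 1) ^ (n + i) * coeff (P_chr H) i = 0"
        unfolding b using IHD(1) IHH(1) by (rule add_nonneg_eq_0_iff)
      also have "\<dots> \<longleftrightarrow> coeff (P_chr D) i = 0 \<and> coeff (P_chr H) i = 0" by simp
      finally show ?thesis using IHD(2)[of i] IHH(2)[of i] ccH ccD ccn by linarith
    qed
    moreover have "coeff (P_chr H) (Suc n) = 0" using IHH(2)[of "Suc n"] by simp
    then have "coeff (P_chr G) (Suc n) = 1" by (simp add: P IHD(3))
    moreover have "coeff (P_chr G) n = - of_nat (card (edges G))"
      by (simp add: P IHD(4) IHH(3) eD)
    ultimately show ?thesis using vG by simp
  qed
qed

lemma sgn_coeff_P_chr:
  assumes "is_graph G" "cc G \<le> i" "i \<le> card (verts G)"
  shows "sgn (coeff (P_chr G) i) = (- 1) ^ (card (verts G) - i)"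
proof -
  have "(- 1) ^ (card (verts G) + i) * coeff (P_chr G) i \<ge> 0" "coeff (P_chr G) i \<noteq> 0"
    using P_chr_coeff[OF assms(1)] assms(2,3) by auto
  moreover have "(- 1) ^ (card (verts G) + i) = ((- 1) ^ (card (verts G) - i) :: rat)"
    using assms(3) by (simp add: uminus_power_if)
  ultimately show ?thesis
    by (cases "even (card (verts G) - i)") (auto simp: sgn_if)
qed

section \<open>The derivative at zero of the components\<close>

lemma is_graph_induced_subgraph:
  assumes "is_graph G" "C \<subseteq> verts G"
  shows "is_graph (induced_subgraph G C)"
  using assms by (auto simp: is_graph_def induced_subgraph_def intro: finite_subset)

text \<open>A path starting in a component never leaves it, so it is a path of the induced subgraph.\<close>

lemma cc_induced_component:
  assumes G: "is_graph G" and C: "C \<in> components G"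
  shows "cc (induced_subgraph G C) = 1"
proof -
  let ?H = "induced_subgraph G C"
  obtain v where v: "v \<in> verts G" "C = reachable G `` {v}"
    using C by (auto simp: components_image)
  have vC: "v \<in> C" using v reachable_refl by fast
  have vH: "verts ?H = C" by (simp add: induced_subgraph_def)
  have path: "(v, b) \<in> reachable ?H" if "b \<in> C" for b
  proof -
    have "(v, b) \<in> {(x, y). {x, y} \<in> edges G}\<^sup>*" using that v by (auto simp: reachable_def)
    then show ?thesis
    proof (induction rule: rtrancl_induct)
      case base
      then show ?case using vC vH reachable_refl by fast
    next
      case (step b c)
      have edge: "{b, c} \<in> edges G" using step.hyps by simp
      then have bc: "b \<in> verts G" "c \<in> verts G" using G by (auto simp: is_graph_def)
      have "b \<in> C" using step.IH vH by (auto simp: reachable_def)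
      moreover from this have "c \<in> C"
        using v(2) reachable_trans[OF _ reachable_edge[OF edge bc]] by blast
      ultimately have "(b, c) \<in> reachable ?H"
        using edge by (intro reachable_edge) (auto simp: induced_subgraph_def)
      then show ?case using step.IH reachable_trans by fast
    qed
  qed
  have "reachable ?H `` {b} = C" if "b \<in> C" for b
  proof
    show "reachable ?H `` {b} \<subseteq> C" using vH by (auto simp: reachable_def)
    show "C \<subseteq> reachable ?H `` {b}" using reachable_trans reachable_sym path that by fast
  qed
  then have "components ?H = {C}" using vC by (auto simp: components_image vH)
  then show ?thesis by (simp add: cc_def)
qed

lemma sgn_prod:
  fixes f :: "'b \<Rightarrow> 'c::linordered_field"
  shows "sgn (prod f A) = (\<Prod>a\<in>A. sgn (f a))"
  by (induction A rule: infinite_finite_induct) (simp_all add: sgn_mult)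

lemma sgn_lambda_chr:
  assumes G: "is_graph G"
  shows "sgn (lambda_chr G) = (- 1) powi graph_deg G"
proof -
  have finV: "finite (verts G)" using G by (simp add: is_graph_def)
  have sub: "C \<subseteq> verts G" if "C \<in> components G" for C
    using that by (auto simp: components_image reachable_def)
  have pos: "card C \<ge> 1" if "C \<in> components G" for C
  proof -
    have "C \<noteq> {}" using that in_quotient_imp_non_empty[OF equiv_reachable]
      unfolding components_def by blast
    then show ?thesis using sub[OF that] finV finite_subset by (metis One_nat_def Suc_leI card_gt_0_iff)
  qed
  have factor: "sgn (poly (pderiv (P_chr (induced_subgraph G C))) 0) = (- 1) ^ (card C - 1)"
    if C: "C \<in> components G" for C
  proof -
    have "poly (pderiv (P_chr (induced_subgraph G C))) 0 = coeff (P_chr (induced_subgraph G C)) 1"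
      by (simp add: poly_0_coeff_0 coeff_pderiv)
    moreover have "verts (induced_subgraph G C) = C" by (simp add: induced_subgraph_def)
    ultimately show ?thesis
      using sgn_coeff_P_chr[OF is_graph_induced_subgraph[OF G sub[OF C]], of 1]
        cc_induced_component[OF G C] pos[OF C] by simp
  qed
  have "\<Union>(components G) = verts G"
    unfolding components_def by (rule Union_quotient[OF equiv_reachable])
  moreover have "card (\<Union>(components G)) = (\<Sum>C\<in>components G. card C)"
  proof (rule card_Union_disjoint)
    show "pairwise disjnt (components G)"
      using quotient_disj[OF equiv_reachable[of G]]
      by (auto simp: pairwise_def disjnt_def components_def)
    show "finite C" if "C \<in> components G" for C using sub[OF that] finV finite_subset by blast
  qed
  ultimately have sum: "(\<Sum>C\<in>components G. card C - 1) = card (verts G) - cc G"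
    using pos by (simp add: sum_subtractf_nat cc_def)
  have "sgn (lambda_chr G) = (\<Prod>C\<in>components G. (- 1) ^ (card C - 1))"
    unfolding lambda_chr_def by (simp add: sgn_prod factor cong: prod.cong)
  also have "\<dots> = (- 1) ^ (card (verts G) - cc G)"
    by (simp only: sum flip: power_sum)
  also have "\<dots> = (- 1) powi graph_deg G"
    using cc_le_card_verts[OF G] by (simp add: graph_deg_def power_int_def nat_diff_distrib)
  finally show ?thesis .
qed

theorem corollary2p12:
  fixes G :: "'a graph"
  assumes "is_graph G"
  shows "(lambda_chr G \<noteq> 0 \<and> sgn (lambda_chr G) = (- 1) powi graph_deg G)
    \<and> (\<forall>i. icoeff (P_chr G) i \<noteq> 0 \<longleftrightarrow> int (cc G) \<le> i \<and> i \<le> int (card (verts G)))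
    \<and> (\<forall>i. int (cc G) \<le> i \<and> i \<le> int (card (verts G)) \<longrightarrow>
          sgn (icoeff (P_chr G) i) = (- 1) powi (int (card (verts G)) - i))
    \<and> - icoeff (P_chr G) (int (card (verts G)) - 1) = of_nat (card (edges G))"
proof (intro conjI allI impI)
  show \<lambda>: "sgn (lambda_chr G) = (- 1) powi graph_deg G" by (rule sgn_lambda_chr[OF assms])
  show "lambda_chr G \<noteq> 0"
  proof
    assume "lambda_chr G = 0"
    then have "(- 1 :: rat) powi graph_deg G = 0" using \<lambda> by simp
    then show False by (simp add: power_int_eq_0_iff)
  qed
  show "icoeff (P_chr G) i \<noteq> 0 \<longleftrightarrow> int (cc G) \<le> i \<and> i \<le> int (card (verts G))" for i
  proof (cases "i < 0")
    case False
    then obtain j where "i = int j" by (metis nonneg_int_cases not_less)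
    then show ?thesis using P_chr_coeff[OF assms] by (simp add: icoeff_def)
  qed (auto simp: icoeff_def)
  show "sgn (icoeff (P_chr G) i) = (- 1) powi (int (card (verts G)) - i)"
    if i: "int (cc G) \<le> i \<and> i \<le> int (card (verts G))" for i
  proof -
    obtain j where "i = int j" using i by (metis nonneg_int_cases of_nat_0_le_iff order_trans)
    then show ?thesis
      using i sgn_coeff_P_chr[OF assms, of j]
      by (simp add: icoeff_def power_int_def nat_diff_distrib)
  qed
  show "- icoeff (P_chr G) (int (card (verts G)) - 1) = of_nat (card (edges G))"
  proof (cases "card (verts G)")
    case 0
    then have "verts G = {}" using assms by (simp add: is_graph_def)
    then have "edges G = {}" using assms by (auto simp: is_graph_def)
    then show ?thesis using 0 by (simp add: icoeff_def)
  next
    case (Suc m)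
    then show ?thesis using P_chr_coeff[OF assms] by (simp add: icoeff_def)
  qed
qed

end
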